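(* Let $\mathcal{S}$ be a trajectory set for which assumption $(L)$-a.e. holds. Let $T<\infty$ be a natural number, $f_0,f_1,\dots,f_T$ a real-valued supermartingale sequence on $\mathcal{S}$ with $f_n\ge c$ for all $0\le n\le T$, where $c$ is a real constant, and let $c\le a<b$. Let $\rho_k,\tau_k$ be the upcrossing times of $[a,b]$: $\tau_0\equiv0$ and, recursively, $$\rho_k(S)=\inf\{n:\tau_k(S)\le n,\ f_n(S)\le a\}\wedge(T+1)\ (k\ge0),$$ $$\tau_k(S)=\inf\{n:\rho_{k-1}(S)\le n,\ f_n(S)\ge b\}\wedge(T+1)\ (k\ge1),$$ with $n$ ranging over $0\le n\le T$ and $\inf\emptyset=\infty$. Then for every $k\ge0$, $$\overline{\sigma}(\mathbf{1}_{\{\tau_{k+1}<T+1\}})\le\Big(\frac{a-c}{b-c}\Big)\,\overline{\sigma}(\mathbf{1}_{\{\rho_k<T+1\}})\le\Big(\frac{a-c}{b-c}\Big)\,\overline{\sigma}(\mathbf{1}_{\{\tau_k<T+1\}}),$$ and so $$\overline{\sigma}(\mathbf{1}_{\{\tau_{k+1}<T+1\}})\le\Big(\frac{a-c}{b-c}\Big)^{k+1}\overline{\sigma}(\mathbf{1}_{\{\rho_0<T+1\}})\le\Big(\frac{a-c}{b-c}\Big)^{k+1}.$$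
   Context: Fix $s_0\in\mathbb{R}$. A trajectory set $\mathcal{S}$ is a set of real sequences $S=(S_i)_{i\ge 0}$ with $S_0=s_0$. For $S\in\mathcal{S}$ and an integer $j\ge 0$, the node $(S,j)$ stands for $\mathcal{S}_{(S,j)}=\{\tilde S\in\mathcal{S}:\tilde S_i=S_i,\ 0\le i\le j\}$. $\mathcal{H}_{(S,j)}$ is the set of sequences $H=(H_i)_{i\ge j}$ of functions $H_i:\mathcal{S}_{(S,j)}\to\mathbb{R}$ that are non-anticipative: $H_i(\tilde S)=H_i(\hat S)$ whenever $\tilde S_k=\hat S_k$ for $j\le k\le i$. For $V\in\mathbb{R}$, $H\in\mathcal{H}_{(S,j)}$, $n\ge j$, put $\Pi^{V,H}_{j,n}(\tilde S)=V+\sum_{i=j}^{n-1}H_i(\tilde S)(\tilde S_{i+1}-\tilde S_i)$ for $\tilde S\in\mathcal{S}_{(S,j)}$. $\mathcal{E}_{(S,j)}$ is the set of all such functions $\Pi^{V,H}_{j,n}$, and $\mathcal{E}^+_{(S,j)}$ the set of its non-negative elements. $Q$ is the set of all functions $\mathcal{S}\to[-\infty,\infty]$ and $P\subseteq Q$ the set of non-negative ones. Conventions: $0\cdot(\pm\infty)=0$, $\infty+(-\infty)=\infty$, $u-v=u+(-v)$, $\inf\emptyset=\infty$. For $f\in Q$ and a node $(S,j)$, $\overline{\sigma}_jf(S)=\inf\sum_{m\ge 0}V^m$, the infimum being over all choices of $f_0=\Pi^{V^0,H^0}_{j,n_0}\in\mathcal{E}_{(S,j)}$ and, for $m\ge1$,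 $f_m=\liminf_{n\to\infty}\Pi^{V^m,H^m}_{j,n}$ with $\Pi^{V^m,H^m}_{j,n}\in\mathcal{E}^+_{(S,j)}$ for all $n\ge j$, such that $f\le\sum_{m\ge0}f_m$ on $\mathcal{S}_{(S,j)}$. For $f\in P$, $\overline{I}_jf(S)=\inf\sum_{m\ge1}V^m$ over all $f_m=\liminf_{n\to\infty}\Pi^{V^m,H^m}_{j,n}$, $m\ge1$, with $\Pi^{V^m,H^m}_{j,n}\in\mathcal{E}^+_{(S,j)}$ for all $n\ge j$, such that $f\le\sum_{m\ge1}f_m$ on $\mathcal{S}_{(S,j)}$. Since all trajectories start at $s_0$, $\overline{\sigma}f:=\overline{\sigma}_0f$ and $\overline{I}f:=\overline{I}_0f$ do not depend on $S$. A set $E\subseteq\mathcal{S}$ is null if $\overline{I}(\mathbf{1}_E)=0$; a property holds a.e. if it holds off a null set. Property $(L_{(S,j)})$: whenever $\Pi^{V,H}_{j,n_f}\in\mathcal{E}_{(S,j)}$ and $f_m=\liminf_{n\to\infty}\Pi^{V^m,H^m}_{j,n}$ with $\Pi^{V^m,H^m}_{j,n}\in\mathcal{E}^+_{(S,j)}$ for all $n\ge j$, $m\ge1$, satisfy $\Pi^{V,H}_{j,n_f}\le\sum_{m\ge1}f_m$ on $\mathcal{S}_{(S,j)}$, then $V\le\sum_{m\ge1}V^m$. Assumption $(L)$-a.e.: $(L_{(S,0)})$ holds, and $\{S\in\mathcal{S}:\exists j\ge0\text{ such that }(L_{(S,j)})\text{ fails}\}$ is a null set. A sequence $f_0,\dots,f_T$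 in $Q$ is a supermartingale if it is non-anticipative ($f_j$ is constant on $\mathcal{S}_{(S,j)}$ for all $S\in\mathcal{S}$ and all $j$) and for each $0\le j<T$, $\overline{\sigma}_jf_{j+1}\le f_j$ a.e. *)

theory Defs
  imports "HOL-Library.Extended_Real" "HOL-Library.Indicator_Function"
begin

(* Functions on a trajectory set or on a node are total functions on sequences; only their
   values on the set in question are ever used.  The conventions 0 * (+-oo) = 0,
   oo + (-oo) = oo and inf {} = oo are those of the type ereal. *)

type_synonym trajectory = "nat \<Rightarrow> real"

definition trajectory_set :: "real \<Rightarrow> trajectory set \<Rightarrow> bool" where
  "trajectory_set s\<^sub>0 \<S> \<longleftrightarrow> (\<forall>S\<in>\<S>. S 0 = s\<^sub>0)"

definition node :: "trajectory set \<Rightarrow> trajectory \<Rightarrow> nat \<Rightarrow> trajectory set" where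
  "node \<S> S j = {S'\<in>\<S>. \<forall>i\<le>j. S' i = S i}"

(* The definitions below depend on a node (S,j) only through the set \<N> = node \<S> S j and the
   time j.  At time 0 this set is the whole trajectory set (lemma node_0). *)

definition strategies :: "trajectory set \<Rightarrow> nat \<Rightarrow> (nat \<Rightarrow> trajectory \<Rightarrow> real) set" where
  "strategies \<N> j = {H. \<forall>i\<ge>j. \<forall>S\<in>\<N>. \<forall>S'\<in>\<N>.
     (\<forall>k. j \<le> k \<and> k \<le> i \<longrightarrow> S k = S' k) \<longrightarrow> H i S = H i S'}"

definition portfolio ::
    "real \<Rightarrow> (nat \<Rightarrow> trajectory \<Rightarrow> real) \<Rightarrow> nat \<Rightarrow> nat \<Rightarrow> trajectory \<Rightarrow> real" where
  "portfolio V H j n S = V + (\<Sum>i=j..<n. H i S * (S (Suc i) - S i))"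

definition liminf_portfolio ::
    "real \<Rightarrow> (nat \<Rightarrow> trajectory \<Rightarrow> real) \<Rightarrow> nat \<Rightarrow> trajectory \<Rightarrow> ereal" where
  "liminf_portfolio V H j S = liminf (\<lambda>n. ereal (portfolio V H j n S))"

(* A sequence (V^m, H^m), re-indexed to start at m = 0 instead of m = 1, all of whose
   portfolios with n \<ge> j are non-negative elements of the space of elementary functions. *)
definition nonneg_family ::
    "trajectory set \<Rightarrow> nat \<Rightarrow> (nat \<Rightarrow> real) \<Rightarrow> (nat \<Rightarrow> nat \<Rightarrow> trajectory \<Rightarrow> real) \<Rightarrow> bool" where
  "nonneg_family \<N> j V H \<longleftrightarrow>
     (\<forall>m. H m \<in> strategies \<N> j \<and> (\<forall>n\<ge>j. \<forall>S\<in>\<N>. 0 \<le> portfolio (V m) (H m) j n S))"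

(* V\<^sub>0, H\<^sub>0, n\<^sub>0 is the term m = 0, which is the only one that may be negative. *)
definition sigma_on :: "trajectory set \<Rightarrow> nat \<Rightarrow> (trajectory \<Rightarrow> ereal) \<Rightarrow> ereal" where
  "sigma_on \<N> j f = Inf {ereal V\<^sub>0 + (\<Sum>m. ereal (V m)) | V\<^sub>0 H\<^sub>0 n\<^sub>0 V H.
     H\<^sub>0 \<in> strategies \<N> j \<and> j \<le> n\<^sub>0 \<and> nonneg_family \<N> j V H \<and>
     (\<forall>S\<in>\<N>. f S \<le> ereal (portfolio V\<^sub>0 H\<^sub>0 j n\<^sub>0 S) + (\<Sum>m. liminf_portfolio (V m) (H m) j S))}"

definition I_on :: "trajectory set \<Rightarrow> nat \<Rightarrow> (trajectory \<Rightarrow> ereal) \<Rightarrow> ereal" where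
  "I_on \<N> j f = Inf {(\<Sum>m. ereal (V m)) | V H.
     nonneg_family \<N> j V H \<and> (\<forall>S\<in>\<N>. f S \<le> (\<Sum>m. liminf_portfolio (V m) (H m) j S))}"

definition L_on :: "trajectory set \<Rightarrow> nat \<Rightarrow> bool" where
  "L_on \<N> j \<longleftrightarrow> (\<forall>V\<^sub>0 H\<^sub>0 n\<^sub>0 V H.
     H\<^sub>0 \<in> strategies \<N> j \<and> j \<le> n\<^sub>0 \<and> nonneg_family \<N> j V H \<and>
     (\<forall>S\<in>\<N>. ereal (portfolio V\<^sub>0 H\<^sub>0 j n\<^sub>0 S) \<le> (\<Sum>m. liminf_portfolio (V m) (H m) j S))
     \<longrightarrow> ereal V\<^sub>0 \<le> (\<Sum>m. ereal (V m)))"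

definition sigma_bar ::
    "trajectory set \<Rightarrow> nat \<Rightarrow> (trajectory \<Rightarrow> ereal) \<Rightarrow> trajectory \<Rightarrow> ereal" where
  "sigma_bar \<S> j f S = sigma_on (node \<S> S j) j f"

definition I_bar ::
    "trajectory set \<Rightarrow> nat \<Rightarrow> (trajectory \<Rightarrow> ereal) \<Rightarrow> trajectory \<Rightarrow> ereal" where
  "I_bar \<S> j f S = I_on (node \<S> S j) j f"

definition L_property :: "trajectory set \<Rightarrow> trajectory \<Rightarrow> nat \<Rightarrow> bool" where
  "L_property \<S> S j \<longleftrightarrow> L_on (node \<S> S j) j"

(* The operators at time 0, which do not depend on S; see sigma_bar_0 and I_bar_0. *)
definition sigma_bar0 :: "trajectory set \<Rightarrow> (trajectory \<Rightarrow> ereal) \<Rightarrow> ereal" where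
  "sigma_bar0 \<S> f = sigma_on \<S> 0 f"

definition I_bar0 :: "trajectory set \<Rightarrow> (trajectory \<Rightarrow> ereal) \<Rightarrow> ereal" where
  "I_bar0 \<S> f = I_on \<S> 0 f"

lemma node_0: "trajectory_set s\<^sub>0 \<S> \<Longrightarrow> S \<in> \<S> \<Longrightarrow> node \<S> S 0 = \<S>"
proof -
  assume s: "trajectory_set s\<^sub>0 \<S>" and S: "S \<in> \<S>"
  have "S' 0 = S 0" if "S' \<in> \<S>" for S'
    using s S that unfolding trajectory_set_def by metis
  then show ?thesis by (auto simp: node_def)
qed

lemma sigma_bar_0: "trajectory_set s\<^sub>0 \<S> \<Longrightarrow> S \<in> \<S> \<Longrightarrow> sigma_bar \<S> 0 f S = sigma_bar0 \<S> f"
  by (simp add: sigma_bar_def sigma_bar0_def node_0)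

lemma I_bar_0: "trajectory_set s\<^sub>0 \<S> \<Longrightarrow> S \<in> \<S> \<Longrightarrow> I_bar \<S> 0 f S = I_bar0 \<S> f"
  by (simp add: I_bar_def I_bar0_def node_0)

definition null :: "trajectory set \<Rightarrow> trajectory set \<Rightarrow> bool" where
  "null \<S> E \<longleftrightarrow> E \<subseteq> \<S> \<and> I_bar0 \<S> (indicator E) = 0"

definition almost_everywhere :: "trajectory set \<Rightarrow> (trajectory \<Rightarrow> bool) \<Rightarrow> bool" where
  "almost_everywhere \<S> P \<longleftrightarrow> (\<exists>E. null \<S> E \<and> (\<forall>S\<in>\<S> - E. P S))"

definition L_ae :: "trajectory set \<Rightarrow> bool" where
  "L_ae \<S> \<longleftrightarrow> (\<forall>S\<in>\<S>. L_property \<S> S 0) \<and> null \<S> {S\<in>\<S>. \<exists>j. \<not> L_property \<S> S j}"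

definition supermartingale ::
    "trajectory set \<Rightarrow> nat \<Rightarrow> (nat \<Rightarrow> trajectory \<Rightarrow> ereal) \<Rightarrow> bool" where
  "supermartingale \<S> T f \<longleftrightarrow>
     (\<forall>j\<le>T. \<forall>S\<in>\<S>. \<forall>S'\<in>node \<S> S j. f j S' = f j S) \<and>
     (\<forall>j<T. almost_everywhere \<S> (\<lambda>S. sigma_bar \<S> j (f (Suc j)) S \<le> f j S))"

(* Inserting T + 1 into the set whose infimum is taken renders "inf, with inf {} = oo, capped
   at T + 1": the other elements are at most T, and the infimum in nat is never over {}. *)
fun rho :: "nat \<Rightarrow> (nat \<Rightarrow> trajectory \<Rightarrow> real) \<Rightarrow> real \<Rightarrow> real \<Rightarrow> nat \<Rightarrow> trajectory \<Rightarrow> nat"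
  and tau :: "nat \<Rightarrow> (nat \<Rightarrow> trajectory \<Rightarrow> real) \<Rightarrow> real \<Rightarrow> real \<Rightarrow> nat \<Rightarrow> trajectory \<Rightarrow> nat"
  where
  "rho T f a b k S = Inf (insert (T + 1) {n. n \<le> T \<and> tau T f a b k S \<le> n \<and> f n S \<le> a})"
| "tau T f a b 0 S = 0"
| "tau T f a b (Suc k) S = Inf (insert (T + 1) {n. n \<le> T \<and> rho T f a b k S \<le> n \<and> f n S \<ge> b})"

(* Unfolding rho and tau is always possible, so they are unsuitable as simplification rules. *)
declare rho.simps [simp del] tau.simps [simp del]

end

theory Submission
  imports Defs "HOL-Analysis.Caratheodory" "HOL-Analysis.Extended_Real_Limits"
begin

text \<open>
  If a superhedge of a claim known at time \<open>T\<close> is stopped at \<open>T\<close>, then by property \<open>(L)\<close> at the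
  time-\<open>T\<close> node its wealth already dominates the claim.  Off the null set of paths that move away
  from a node with one-sided increments, the infinitely many positions of the superhedge are summable
  and merge into one strategy.  Hence \<open>\<sigma>\<close> of such a claim is governed by finite-horizon strategies
  dominating it a.e.; this applies to the claim \<open>\<rho>\<^sub>k < T + 1\<close> at time \<open>0\<close> and to \<open>f\<^sub>j\<^sub>+\<^sub>1\<close> at time \<open>j\<close>.
  Finite-horizon strategies can be
  added: \<open>a - c\<close> hedges of \<open>\<rho>\<^sub>k < T + 1\<close> plus the one-step supermartingale hedges held from \<open>\<rho>\<^sub>k\<close>
  until \<open>\<tau>\<^sub>k\<^sub>+\<^sub>1\<close> end up above \<open>b - c\<close> on \<open>\<tau>\<^sub>k\<^sub>+\<^sub>1 < T + 1\<close>, up to an arbitrarily small error.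
\<close>

section \<open>Series of nonnegative extended reals\<close>

text \<open>Tonelli for series, transported from \<open>ennreal\<close>. It lets countably many
  families of portfolios be listed as a single family.\<close>

lemma suminf_ereal_prod_decode:
  fixes f :: "nat \<times> nat \<Rightarrow> ereal"
  assumes "\<And>x. 0 \<le> f x"
  shows "(\<Sum>i. f (prod_decode i)) = (\<Sum>m. \<Sum>n. f (m, n))"
proof -
  define g where "g x = e2ennreal (f x)" for x
  have f: "f x = enn2ereal (g x)" for x
    using assms by (simp add: g_def enn2ereal_e2ennreal)
  have "(\<Sum>i. g (prod_decode i)) = (\<Sum>m. \<Sum>n. g (m, n))"
    by (rule suminf_ennreal_2dimen) simp
  then show ?thesis
    by (simp add: f)
qed

lemma suminf_ereal_const_pos:
  assumes "0 < (x::ereal)"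
  shows "(\<Sum>n::nat. x) = \<infinity>"
proof (cases x)
  case (real r)
  with assms have "r > 0" by simp
  then have "\<not> summable (\<lambda>n::nat. r)"
    by (simp add: summable_const_iff)
  then show ?thesis
    using summable_ereal[of "\<lambda>_. r"] \<open>r > 0\<close> real by force
qed (use assms in auto)

lemma suminf_ereal_nth_le:
  fixes f :: "nat \<Rightarrow> ereal"
  assumes "\<And>n. 0 \<le> f n"
  shows "f k \<le> (\<Sum>n. f n)"
proof -
  have "f k \<le> (\<Sum>n<Suc k. f n)"
    using assms by (simp add: sum_nonneg add_increasing)
  also have "\<dots> \<le> (\<Sum>n. f n)"
    by (rule suminf_upper) (rule assms)
  finally show ?thesis .
qed

section \<open>Nodes, strategies and portfolios\<close>

lemma node_subset: "node \<S> S j \<subseteq> \<S>"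
  by (auto simp: node_def)

lemma node_self: "S \<in> \<S> \<Longrightarrow> S \<in> node \<S> S j"
  by (simp add: node_def)

lemma node_eq: "S' \<in> node \<S> S j \<Longrightarrow> node \<S> S' j = node \<S> S j"
  by (auto simp: node_def)

lemma node_antimono: "i \<le> j \<Longrightarrow> S' \<in> node \<S> S j \<Longrightarrow> S' \<in> node \<S> S i"
  by (auto simp: node_def)

lemma node_node_subset: "S' \<in> node \<S> S j \<Longrightarrow> j \<le> n \<Longrightarrow> node \<S> S' n \<subseteq> node \<S> S j"
  by (auto simp: node_def)

text \<open>Inside a time-\<open>n\<close> node all paths share their coordinates up to
  \<open>n\<close>, so agreement from \<open>n\<close> to \<open>i\<close> is already agreement from
  \<open>j\<close> to \<open>i\<close>.\<close>

lemma strategies_node_mono: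
  assumes "H \<in> strategies \<N> j" "j \<le> n" "node \<S> S n \<subseteq> \<N>"
  shows "H \<in> strategies (node \<S> S n) n"
  unfolding strategies_def
proof (clarify)
  fix i S1 S2
  assume i: "n \<le> i" and S: "S1 \<in> node \<S> S n" "S2 \<in> node \<S> S n"
    and eq: "\<forall>k. n \<le> k \<and> k \<le> i \<longrightarrow> S1 k = S2 k"
  have "S1 k = S2 k" if "k \<le> i" for k
    using S eq that by (cases "n \<le> k") (auto simp: node_def)
  then show "H i S1 = H i S2"
    using assms i S unfolding strategies_def by (auto simp: subset_iff)
qed

lemma strategies_add:
  "H \<in> strategies \<N> j \<Longrightarrow> K \<in> strategies \<N> j \<Longrightarrow> (\<lambda>i S. H i S + K i S) \<in> strategies \<N> j"
  unfolding strategies_def mem_Collect_eq by metis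

lemma strategies_cmult:
  "H \<in> strategies \<N> j \<Longrightarrow> (\<lambda>i S. r * H i S) \<in> strategies \<N> j"
  unfolding strategies_def mem_Collect_eq by metis

lemma strategies_truncate:
  "H \<in> strategies \<N> j \<Longrightarrow> (\<lambda>i S. if i < n then H i S else 0) \<in> strategies \<N> j"
  unfolding strategies_def mem_Collect_eq by metis

lemma strategies_zero: "(\<lambda>_ _. 0) \<in> strategies \<N> j"
  by (simp add: strategies_def)

text \<open>The two series agree term by term, so their \<open>suminf\<close> values agree whether
  or not the series converge.\<close>

lemma strategies_suminf:
  assumes "\<And>m. H m \<in> strategies \<N> j"
  shows "(\<lambda>i S. \<Sum>m. H m i S) \<in> strategies \<N> j"
  unfolding strategies_def
proof (clarify)
  fix i S S'
  assume "j \<le> i" "S \<in> \<N>" "S' \<in> \<N>" "\<forall>k. j \<le> k \<and> k \<le> i \<longrightarrow> S k = S' k"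
  then have "H m i S = H m i S'" for m
    using assms[of m] unfolding strategies_def by blast
  then show "(\<Sum>m. H m i S) = (\<Sum>m. H m i S')" by simp
qed

lemma strategies_eq_on_node:
  assumes "H \<in> strategies \<N> j" "j \<le> i" "S \<in> \<N>" "S' \<in> \<N>" "S' \<in> node \<S> S i"
  shows "H i S' = H i S"
proof -
  have "\<forall>k. j \<le> k \<and> k \<le> i \<longrightarrow> S' k = S k"
    using assms(5) by (simp add: node_def)
  then show ?thesis
    using assms(1-4) unfolding strategies_def by blast
qed

lemma strategiesI_node:
  assumes "trajectory_set s\<^sub>0 \<S>"
    and "\<And>i S S'. S \<in> \<S> \<Longrightarrow> S' \<in> node \<S> S i \<Longrightarrow> H i S' = H i S"
  shows "H \<in> strategies \<S> 0"
  unfolding strategies_def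
proof (clarify)
  fix i S S'
  assume "S \<in> \<S>" "S' \<in> \<S>" "\<forall>k. 0 \<le> k \<and> k \<le> i \<longrightarrow> S k = S' k"
  then show "H i S = H i S'"
    using assms(2)[of S S' i] by (simp add: node_def)
qed

lemma portfolio_self [simp]: "portfolio V H j j S = V"
  by (simp add: portfolio_def)

lemma portfolio_Suc:
  "j \<le> n \<Longrightarrow> portfolio V H j (Suc n) S = portfolio V H j n S + H n S * (S (Suc n) - S n)"
  by (simp add: portfolio_def)

lemma portfolio_split:
  "j \<le> n \<Longrightarrow> n \<le> p \<Longrightarrow> portfolio V H j p S = portfolio (portfolio V H j n S) H n p S"
  by (simp add: portfolio_def sum.atLeastLessThan_concat[of j n p, symmetric])

lemma portfolio_add:
  "portfolio (V + W) (\<lambda>i S. H i S + K i S) j n S = portfolio V H j n S + portfolio W K j n S"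
  by (simp add: portfolio_def distrib_right sum.distrib)

lemma portfolio_cmult:
  "portfolio (r * V) (\<lambda>i S. r * H i S) j n S = r * portfolio V H j n S"
  by (simp add: portfolio_def sum_distrib_left algebra_simps)

text \<open>Zero positions from \<open>n\<close> on freeze the wealth, so a payoff at horizon
  \<open>n\<close> can be read off at any later horizon.\<close>

lemma portfolio_truncate:
  assumes "j \<le> n" "n \<le> p"
  shows "portfolio V (\<lambda>i S. if i < n then H i S else 0) j p S = portfolio V H j n S"
proof -
  have "(\<Sum>i = n..<p. (if i < n then H i S else 0) * (S (Suc i) - S i)) = 0"
    by (intro sum.neutral) auto
  then show ?thesis
    unfolding portfolio_def
    by (subst sum.atLeastLessThan_concat[of j n p, symmetric]) (use assms in auto)
qed

lemma portfolio_eq_on_node: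
  assumes H: "H \<in> strategies \<N> j" "j \<le> n" "S \<in> \<N>" "S' \<in> \<N>" "S' \<in> node \<S> S n"
  shows "portfolio V H j n S' = portfolio V H j n S"
proof -
  have "H i S' * (S' (Suc i) - S' i) = H i S * (S (Suc i) - S i)" if "i \<in> {j..<n}" for i
  proof -
    have "H i S' = H i S"
      using that assms by (intro strategies_eq_on_node[OF H(1)]) (auto intro: node_antimono[of i n])
    then show ?thesis
      using that H(5) by (simp add: node_def)
  qed
  then show ?thesis by (simp add: portfolio_def)
qed

text \<open>Restarting at time \<open>n\<close> with the current wealth as capital reproduces the
  wealth at every time from \<open>n\<close> on, and the liminf sees only those times.\<close>

lemma liminf_portfolio_split:
  assumes "j \<le> n"
  shows "liminf_portfolio (portfolio V H j n S) H n S = liminf_portfolio V H j S"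
  unfolding liminf_portfolio_def
proof (rule Liminf_eq)
  have "ereal (portfolio (portfolio V H j n S) H n p S) = ereal (portfolio V H j p S)" if "n \<le> p" for p
    using portfolio_split[OF assms that, of V H S] by simp
  then show "\<forall>\<^sub>F p in sequentially. ereal (portfolio (portfolio V H j n S) H n p S) = ereal (portfolio V H j p S)"
    by (auto simp: eventually_at_top_linorder)
qed

lemma liminf_portfolio_nonneg:
  assumes "nonneg_family \<N> j V H" "S \<in> \<N>"
  shows "0 \<le> liminf_portfolio (V m) (H m) j S"
  unfolding liminf_portfolio_def
  by (rule Liminf_bounded)
    (use assms in \<open>auto simp: eventually_at_top_linorder nonneg_family_def intro!: exI[of _ j]\<close>)

lemma nonneg_family_capital:
  assumes "nonneg_family \<N> j V H" "\<N> \<noteq> {}"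
  shows "0 \<le> V m"
proof -
  obtain S where "S \<in> \<N>" using assms by blast
  then have "0 \<le> portfolio (V m) (H m) j j S"
    using assms(1) unfolding nonneg_family_def by blast
  then show ?thesis by simp
qed

section \<open>Upper bounds for the superhedging price\<close>

lemma sigma_on_lower:
  assumes "H\<^sub>0 \<in> strategies \<N> j" "j \<le> n\<^sub>0" "nonneg_family \<N> j V H"
    and "\<And>S. S \<in> \<N> \<Longrightarrow>
      f S \<le> ereal (portfolio V\<^sub>0 H\<^sub>0 j n\<^sub>0 S) + (\<Sum>m. liminf_portfolio (V m) (H m) j S)"
  shows "sigma_on \<N> j f \<le> ereal V\<^sub>0 + (\<Sum>m. ereal (V m))"
  unfolding sigma_on_def
  apply (rule Inf_lower, rule CollectI)
  apply (rule exI[of _ V\<^sub>0], rule exI[of _ H\<^sub>0], rule exI[of _ n\<^sub>0], rule exI[of _ V], rule exI[of _ H])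
  using assms by simp

lemma sigma_on_mono:
  assumes "\<And>S. S \<in> \<N> \<Longrightarrow> f S \<le> g S"
  shows "sigma_on \<N> j f \<le> sigma_on \<N> j g"
  unfolding sigma_on_def[of _ _ g]
proof (rule Inf_greatest, clarify)
  fix V0 H0 n0 V H
  assume *: "H0 \<in> strategies \<N> j" "j \<le> n0" "nonneg_family \<N> j V H"
    and le: "\<forall>S\<in>\<N>. g S \<le> ereal (portfolio V0 H0 j n0 S) + (\<Sum>m. liminf_portfolio (V m) (H m) j S)"
  show "sigma_on \<N> j f \<le> ereal V0 + (\<Sum>m. ereal (V m))"
    by (rule sigma_on_lower[OF *]) (rule order_trans[OF assms le[rule_format]])
qed

section \<open>Negligible sets\<close>

text \<open>Null sets in the form in which hedges use them: arbitrarily small capital buys an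
  infinite payoff on the set. An infinite payoff, unlike a payoff of 1, covers a claim of any size
  there.\<close>

definition negligible :: "trajectory set \<Rightarrow> trajectory set \<Rightarrow> bool" where
  "negligible \<S> E \<longleftrightarrow> (\<forall>\<epsilon>>0. \<exists>V H. nonneg_family \<S> 0 V H \<and> (\<Sum>m. ereal (V m)) \<le> ereal \<epsilon> \<and>
     (\<forall>S\<in>\<S> \<inter> E. (\<Sum>m. liminf_portfolio (V m) (H m) 0 S) = \<infinity>))"

text \<open>The claim \<open>g k\<close> is hedged with capital at most \<epsilon> / 2^(k+1), and
  the double sequence of portfolios is enumerated by \<open>prod_decode\<close>. Nonnegative
  capitals and payoffs make both rearrangements legitimate.\<close>

lemma nonneg_family_merge:
  assumes ne: "\<S> \<noteq> {}" and \<epsilon>: "0 < (\<epsilon>::real)"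
    and fam: "\<And>k \<delta>. 0 < (\<delta>::real) \<Longrightarrow> \<exists>V H. nonneg_family \<S> 0 V H \<and> (\<Sum>m. ereal (V m)) \<le> ereal \<delta> \<and>
       (\<forall>S\<in>\<S>. g k S \<le> (\<Sum>m. liminf_portfolio (V m) (H m) 0 S))"
    and g: "\<And>k S. S \<in> \<S> \<Longrightarrow> 0 \<le> g k S"
  shows "\<exists>V H. nonneg_family \<S> 0 V H \<and> (\<Sum>m. ereal (V m)) \<le> ereal \<epsilon> \<and>
       (\<forall>S\<in>\<S>. (\<Sum>k. g k S) \<le> (\<Sum>m. liminf_portfolio (V m) (H m) 0 S))"
proof -
  define P where "P k V H \<longleftrightarrow> nonneg_family \<S> 0 V H \<and>
      (\<Sum>m. ereal (V m)) \<le> ereal (\<epsilon> * (1/2) ^ Suc k) \<and>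
      (\<forall>S\<in>\<S>. g k S \<le> (\<Sum>m. liminf_portfolio (V m) (H m) 0 S))" for k V H
  have "\<exists>V H. P k V H" for k
    unfolding P_def by (rule fam) (use \<epsilon> in simp)
  then obtain V H where P: "\<And>k. P k (V k) (H k)"
    by metis
  have VH: "\<And>k. nonneg_family \<S> 0 (V k) (H k)"
      "\<And>k. (\<Sum>m. ereal (V k m)) \<le> ereal (\<epsilon> * (1/2) ^ Suc k)"
      "\<And>k S. S \<in> \<S> \<Longrightarrow> g k S \<le> (\<Sum>m. liminf_portfolio (V k m) (H k m) 0 S)"
    using P unfolding P_def by blast+
  define V' where "V' i = V (fst (prod_decode i)) (snd (prod_decode i))" for i
  define H' where "H' i = H (fst (prod_decode i)) (snd (prod_decode i))" for i
  have V: "0 \<le> V k m" for k m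
    using nonneg_family_capital[OF VH(1) ne] .
  have "nonneg_family \<S> 0 V' H'"
    using VH(1) by (auto simp: nonneg_family_def V'_def H'_def)
  moreover have "(\<Sum>i. ereal (V' i)) \<le> ereal \<epsilon>"
  proof -
    have "(\<Sum>i. ereal (V' i)) = (\<Sum>k. \<Sum>m. ereal (V k m))"
      using suminf_ereal_prod_decode[of "\<lambda>x. ereal (V (fst x) (snd x))"] V by (simp add: V'_def)
    also have "\<dots> \<le> (\<Sum>k. ereal (\<epsilon> * (1/2) ^ Suc k))"
      by (intro suminf_le_pos VH(2) suminf_0_le) (simp add: V)
    also have "\<dots> = ereal \<epsilon>"
      using sums_suminf_ereal[OF sums_mult[OF power_half_series, of \<epsilon>]] by simp
    finally show ?thesis .
  qed
  moreover have "(\<Sum>k. g k S) \<le> (\<Sum>i. liminf_portfolio (V' i) (H' i) 0 S)" if S: "S \<in> \<S>" for S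
  proof -
    have "(\<Sum>k. g k S) \<le> (\<Sum>k. \<Sum>m. liminf_portfolio (V k m) (H k m) 0 S)"
      by (intro suminf_le_pos VH(3) g S)
    also have "\<dots> = (\<Sum>i. liminf_portfolio (V' i) (H' i) 0 S)"
      using suminf_ereal_prod_decode[of "\<lambda>x. liminf_portfolio (V (fst x) (snd x)) (H (fst x) (snd x)) 0 S"]
        liminf_portfolio_nonneg[OF VH(1) S] by (simp add: V'_def H'_def)
    finally show ?thesis .
  qed
  ultimately show ?thesis by blast
qed

text \<open>Infinitely many ever cheaper hedges of the same indicator are merged; on
  \<open>E\<close> the total payoff is a series of ones, hence infinite.\<close>

lemma negligible_null:
  assumes ne: "\<S> \<noteq> {}" and "null \<S> E"
  shows "negligible \<S> E"
  unfolding negligible_def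
proof (clarify)
  fix \<epsilon> :: real assume "0 < \<epsilon>"
  have "\<exists>V H. nonneg_family \<S> 0 V H \<and> (\<Sum>m. ereal (V m)) \<le> ereal \<epsilon> \<and>
       (\<forall>S\<in>\<S>. (\<Sum>k::nat. indicator E S :: ereal) \<le> (\<Sum>m. liminf_portfolio (V m) (H m) 0 S))"
  proof (rule nonneg_family_merge[OF ne \<open>0 < \<epsilon>\<close>])
    fix \<delta> :: real assume "0 < \<delta>"
    then have "I_on \<S> 0 (indicator E) < ereal \<delta>"
      using assms(2) by (simp add: null_def I_bar0_def)
    then show "\<exists>V H. nonneg_family \<S> 0 V H \<and> (\<Sum>m. ereal (V m)) \<le> ereal \<delta> \<and>
       (\<forall>S\<in>\<S>. (indicator E S :: ereal) \<le> (\<Sum>m. liminf_portfolio (V m) (H m) 0 S))"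
      unfolding I_on_def Inf_less_iff by (auto intro: less_imp_le)
  qed (simp add: indicator_def)
  then obtain V H where VH: "nonneg_family \<S> 0 V H" "(\<Sum>m. ereal (V m)) \<le> ereal \<epsilon>"
      "\<And>S. S \<in> \<S> \<Longrightarrow> (\<Sum>k::nat. indicator E S :: ereal) \<le> (\<Sum>m. liminf_portfolio (V m) (H m) 0 S)"
    by blast
  have "(\<Sum>m. liminf_portfolio (V m) (H m) 0 S) = \<infinity>" if "S \<in> \<S> \<inter> E" for S
    using VH(3)[of S] that suminf_ereal_const_pos[of 1] by simp
  with VH show "\<exists>V H. nonneg_family \<S> 0 V H \<and> (\<Sum>m. ereal (V m)) \<le> ereal \<epsilon> \<and>
     (\<forall>S\<in>\<S> \<inter> E. (\<Sum>m. liminf_portfolio (V m) (H m) 0 S) = \<infinity>)"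
    by blast
qed

text \<open>The merged claims are \<infinity> times the indicators of the sets \<open>E k\<close>. A
  path in one of these sets makes one summand, and so the whole series, infinite.\<close>

lemma negligible_UN:
  assumes ne: "\<S> \<noteq> {}" and E: "\<And>k::nat. negligible \<S> (E k)"
  shows "negligible \<S> (\<Union>k. E k)"
  unfolding negligible_def
proof (clarify)
  fix \<epsilon> :: real assume "0 < \<epsilon>"
  have "\<exists>V H. nonneg_family \<S> 0 V H \<and> (\<Sum>m. ereal (V m)) \<le> ereal \<epsilon> \<and>
       (\<forall>S\<in>\<S>. (\<Sum>k. \<infinity> * indicator (E k) S :: ereal) \<le> (\<Sum>m. liminf_portfolio (V m) (H m) 0 S))"
  proof (rule nonneg_family_merge[OF ne \<open>0 < \<epsilon>\<close>])
    fix k and \<delta> :: real assume "0 < \<delta>"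
    then obtain V H where VH: "nonneg_family \<S> 0 V H" "(\<Sum>m. ereal (V m)) \<le> ereal \<delta>"
        "\<And>S. S \<in> \<S> \<Longrightarrow> S \<in> E k \<Longrightarrow> (\<Sum>m. liminf_portfolio (V m) (H m) 0 S) = \<infinity>"
      using E[of k] unfolding negligible_def by blast
    have "\<infinity> * indicator (E k) S \<le> (\<Sum>m. liminf_portfolio (V m) (H m) 0 S)" if "S \<in> \<S>" for S
      using VH(3)[OF that] suminf_0_le[OF liminf_portfolio_nonneg[OF VH(1) that]]
      by (cases "S \<in> E k") auto
    with VH show "\<exists>V H. nonneg_family \<S> 0 V H \<and> (\<Sum>m. ereal (V m)) \<le> ereal \<delta> \<and>
       (\<forall>S\<in>\<S>. \<infinity> * indicator (E k) S \<le> (\<Sum>m. liminf_portfolio (V m) (H m) 0 S))"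
      by blast
  qed (simp add: indicator_def)
  then obtain V H where VH: "nonneg_family \<S> 0 V H" "(\<Sum>m. ereal (V m)) \<le> ereal \<epsilon>"
      "\<And>S. S \<in> \<S> \<Longrightarrow> (\<Sum>k. \<infinity> * indicator (E k) S :: ereal) \<le> (\<Sum>m. liminf_portfolio (V m) (H m) 0 S)"
    by blast
  have "(\<Sum>m. liminf_portfolio (V m) (H m) 0 S) = \<infinity>" if S: "S \<in> \<S> \<inter> (\<Union>k. E k)" for S
  proof -
    obtain k where "S \<in> E k" using S by blast
    then have "\<infinity> \<le> (\<Sum>k. \<infinity> * indicator (E k) S :: ereal)"
      using suminf_ereal_nth_le[of "\<lambda>k. \<infinity> * indicator (E k) S" k] by (simp add: indicator_def)
    then show ?thesis using VH(3)[of S] S by force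
  qed
  with VH show "\<exists>V H. nonneg_family \<S> 0 V H \<and> (\<Sum>m. ereal (V m)) \<le> ereal \<epsilon> \<and>
     (\<forall>S\<in>\<S> \<inter> (\<Union>k. E k). (\<Sum>m. liminf_portfolio (V m) (H m) 0 S) = \<infinity>)"
    by blast
qed

lemma negligible_Un:
  assumes "\<S> \<noteq> {}" "negligible \<S> E" "negligible \<S> F"
  shows "negligible \<S> (E \<union> F)"
proof -
  have "negligible \<S> (\<Union>k::nat. if k = 0 then E else F)"
    using assms by (intro negligible_UN) auto
  moreover have "(\<Union>k::nat. if k = 0 then E else F) = E \<union> F"
    by (auto split: if_splits)
  ultimately show ?thesis by simp
qed

text \<open>A family of cost at most \<epsilon> with infinite payoff on \<open>E\<close> is added to
  the portfolio; this turns domination off \<open>E\<close> into domination everywhere, and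
  \<epsilon> is arbitrary.\<close>

lemma sigma_bar0_le_portfolio:
  assumes "\<S> \<noteq> {}" and H: "H \<in> strategies \<S> 0" and "negligible \<S> E"
    and le: "\<And>S. S \<in> \<S> - E \<Longrightarrow> f S \<le> ereal (portfolio V H 0 n S)"
  shows "sigma_bar0 \<S> f \<le> ereal V"
proof (rule ereal_le_epsilon2)
  fix \<epsilon> :: real assume "0 < \<epsilon>"
  then obtain W K where WK: "nonneg_family \<S> 0 W K" "(\<Sum>m. ereal (W m)) \<le> ereal \<epsilon>"
      "\<And>S. S \<in> \<S> \<Longrightarrow> S \<in> E \<Longrightarrow> (\<Sum>m. liminf_portfolio (W m) (K m) 0 S) = \<infinity>"
    using assms(3) unfolding negligible_def by blast
  have "f S \<le> ereal (portfolio V H 0 n S) + (\<Sum>m. liminf_portfolio (W m) (K m) 0 S)"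
    if S: "S \<in> \<S>" for S
  proof (cases "S \<in> E")
    case False
    then show ?thesis
      using le[of S] S suminf_0_le[OF liminf_portfolio_nonneg[OF WK(1) S]]
      by (simp add: add_increasing2)
  qed (simp add: WK(3) S)
  then have "sigma_on \<S> 0 f \<le> ereal V + (\<Sum>m. ereal (W m))"
    by (rule sigma_on_lower[OF H le0 WK(1)])
  also have "\<dots> \<le> ereal V + ereal \<epsilon>"
    by (rule add_left_mono) (rule WK(2))
  finally show "sigma_bar0 \<S> f \<le> ereal V + ereal \<epsilon>"
    by (simp add: sigma_bar0_def)
qed

section \<open>Positivity of the price under (L)\<close>

lemma L_onD:
  assumes "L_on \<N> j" "H\<^sub>0 \<in> strategies \<N> j" "j \<le> n\<^sub>0" "nonneg_family \<N> j V H"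
    and "\<And>S. S \<in> \<N> \<Longrightarrow>
      ereal (portfolio V\<^sub>0 H\<^sub>0 j n\<^sub>0 S) \<le> (\<Sum>m. liminf_portfolio (V m) (H m) j S)"
  shows "ereal V\<^sub>0 \<le> (\<Sum>m. ereal (V m))"
  using assms(1)[unfolded L_on_def, THEN spec[of _ V\<^sub>0], THEN spec[of _ H\<^sub>0], THEN spec[of _ n\<^sub>0],
      THEN spec[of _ V], THEN spec[of _ H]] assms(2-)
  by simp

text \<open>If a superhedge dominates a nonnegative claim, its liminf part dominates the negated
  elementary part, and (L) compares the capitals of these two.\<close>

lemma sigma_bar0_nonneg:
  assumes L: "L_on \<S> 0" and f: "\<And>S. S \<in> \<S> \<Longrightarrow> 0 \<le> f S"
  shows "0 \<le> sigma_bar0 \<S> f"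
  unfolding sigma_bar0_def sigma_on_def
proof (rule Inf_greatest, clarify)
  fix V0 H0 n0 V H
  assume H0: "H0 \<in> strategies \<S> 0" and fam: "nonneg_family \<S> 0 V H"
    and le: "\<forall>S\<in>\<S>. f S \<le> ereal (portfolio V0 H0 0 n0 S) + (\<Sum>m. liminf_portfolio (V m) (H m) 0 S)"
  have neg: "(\<lambda>i S. - 1 * H0 i S) \<in> strategies \<S> 0"
    by (rule strategies_cmult[OF H0])
  have "ereal (portfolio (- 1 * V0) (\<lambda>i S. - 1 * H0 i S) 0 n0 S)
      \<le> (\<Sum>m. liminf_portfolio (V m) (H m) 0 S)" if "S \<in> \<S>" for S
    using order_trans[OF f[OF that] le[rule_format, OF that]] unfolding portfolio_cmult
    by (cases "\<Sum>m. liminf_portfolio (V m) (H m) 0 S") auto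
  then have "ereal (- 1 * V0) \<le> (\<Sum>m. ereal (V m))"
    by (rule L_onD[OF L neg le0 fam])
  then show "0 \<le> ereal V0 + (\<Sum>m. ereal (V m))"
    by (cases "\<Sum>m. ereal (V m)") auto
qed

section \<open>One-sided nodes, aggregation and finite-horizon hedges\<close>

text \<open>The negation provides both a strict up move and a strict down move from the node. Flat
  nodes count as one-sided, but no path moves there.\<close>

definition one_sided :: "trajectory set \<Rightarrow> nat \<Rightarrow> trajectory \<Rightarrow> bool" where
  "one_sided \<S> i S \<longleftrightarrow>
     (\<forall>S'\<in>node \<S> S i. S' i \<le> S' (Suc i)) \<or> (\<forall>S'\<in>node \<S> S i. S' (Suc i) \<le> S' i)"

definition arbitrage_paths :: "trajectory set \<Rightarrow> trajectory set" where
  "arbitrage_paths \<S> = {S\<in>\<S>. \<exists>i. one_sided \<S> i S \<and> S (Suc i) \<noteq> S i}"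

text \<open>Holding one unit in the permitted direction during step \<open>i\<close> costs nothing,
  never loses, and gains strictly on the paths in question. Infinitely many copies of this strategy
  pay \<infinity> there at zero cost.\<close>

lemma negligible_one_sided_move:
  assumes tr: "trajectory_set s\<^sub>0 \<S>"
  shows "negligible \<S> {S\<in>\<S>. one_sided \<S> i S \<and> S (Suc i) \<noteq> S i}"
proof -
  \<comment> \<open>The permitted direction, constant on each node; the value 0 at two-sided nodes
    avoids any risk there.\<close>
  define d :: "trajectory \<Rightarrow> real" where
    "d S = (if \<forall>S'\<in>node \<S> S i. S' i \<le> S' (Suc i) then 1
            else if \<forall>S'\<in>node \<S> S i. S' (Suc i) \<le> S' i then - 1 else 0)" for S
  define H where "H m l S = (if l = i then d S else 0)" for m l :: nat and S
  have d_node: "d S' = d S" if "S' \<in> node \<S> S i" for S S'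
    using node_eq[OF that] by (simp add: d_def)
  have d_nonneg: "0 \<le> d S * (S (Suc i) - S i)" if "S \<in> \<S>" for S
    using node_self[OF that, of i] by (auto simp: d_def)
  have pf: "portfolio 0 (H m) 0 n S = (if i < n then d S * (S (Suc i) - S i) else 0)" for m n S
  proof -
    have "H m l S * (S (Suc l) - S l) = (if l = i then d S * (S (Suc i) - S i) else 0)" for l
      by (simp add: H_def)
    then show ?thesis by (simp add: portfolio_def)
  qed
  have lim: "liminf_portfolio 0 (H m) 0 S = ereal (d S * (S (Suc i) - S i))" for m S
  proof -
    have "liminf_portfolio 0 (H m) 0 S = liminf (\<lambda>n. ereal (d S * (S (Suc i) - S i)))"
      unfolding liminf_portfolio_def
      by (rule Liminf_eq) (auto simp: eventually_at_top_linorder pf intro!: exI[of _ "Suc i"])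
    then show ?thesis by (simp add: Liminf_const)
  qed
  have "H m \<in> strategies \<S> 0" for m
    by (rule strategiesI_node[OF tr]) (auto simp: H_def intro: d_node)
  then have "nonneg_family \<S> 0 (\<lambda>_. 0) H"
    using d_nonneg by (simp add: nonneg_family_def pf)
  moreover have "(\<Sum>m. liminf_portfolio 0 (H m) 0 S) = \<infinity>"
    if "S \<in> {S\<in>\<S>. one_sided \<S> i S \<and> S (Suc i) \<noteq> S i}" for S
  proof -
    have "d S \<noteq> 0" "S \<in> \<S>" "S (Suc i) \<noteq> S i"
      using that by (auto simp: d_def one_sided_def)
    then have "0 < d S * (S (Suc i) - S i)"
      using d_nonneg[of S] by (simp add: order_less_le)
    then show ?thesis
      unfolding lim by (intro suminf_ereal_const_pos) simp
  qed
  ultimately show ?thesis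
    unfolding negligible_def
    by (intro allI impI exI[of _ "\<lambda>_. 0"] exI[of _ H]) (auto simp flip: zero_ereal_def)
qed

lemma negligible_arbitrage_paths:
  assumes "trajectory_set s\<^sub>0 \<S>" "\<S> \<noteq> {}"
  shows "negligible \<S> (arbitrage_paths \<S>)"
proof -
  have "arbitrage_paths \<S> = (\<Union>i. {S\<in>\<S>. one_sided \<S> i S \<and> S (Suc i) \<noteq> S i})"
    by (auto simp: arbitrage_paths_def)
  then show ?thesis
    using negligible_UN[OF assms(2) negligible_one_sided_move[OF assms(1)]] by simp
qed

text \<open>At a node with both an up and a down move, nonnegativity after either move bounds each
  position by a multiple of the current wealth, so a summable family of nonnegative portfolios has
  summable positions; at a one-sided node the positions are multiplied by a zero increment.\<close>

lemma nonneg_family_aggregate: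
  assumes fam: "nonneg_family (node \<S> S j) j V H" and V: "summable V"
    and S': "S' \<in> node \<S> S j" "S' \<notin> arbitrage_paths \<S>" and "j \<le> n"
  shows "(\<lambda>m. portfolio (V m) (H m) j n S') sums
    portfolio (\<Sum>m. V m) (\<lambda>i S. \<Sum>m. H m i S) j n S'"
  using \<open>j \<le> n\<close>
proof (induction n rule: nat_induct_at_least)
  case base
  then show ?case using V by (simp add: summable_sums)
next
  case (Suc n)
  let ?p = "\<lambda>m. portfolio (V m) (H m) j n S'"
  show ?case
  proof (cases "S' (Suc n) = S' n")
    \<comment> \<open>The positions need not be summable here: whatever value \<open>suminf\<close>
      takes, it is multiplied by the increment 0.\<close>
    case True
    then show ?thesis using Suc by (simp add: portfolio_Suc)
  next
    case False
    have "S' \<in> \<S>" using S'(1) node_subset by blast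
    then have "\<not> one_sided \<S> n S'"
      using False S'(2) by (auto simp: arbitrage_paths_def)
    then obtain D U where D: "D \<in> node \<S> S' n" "D (Suc n) < D n"
      and U: "U \<in> node \<S> S' n" "U n < U (Suc n)"
      unfolding one_sided_def by (auto simp: not_le)
    define u where "u = U (Suc n) - U n"
    define d where "d = D n - D (Suc n)"
    have ud: "0 < u" "0 < d" using D U by (simp_all add: u_def d_def)
    have N: "X \<in> node \<S> S j" if "X \<in> node \<S> S' n" for X
      using node_node_subset[OF S'(1) Suc.hyps] that by blast
    have str: "H m \<in> strategies (node \<S> S j) j" for m
      using fam by (simp add: nonneg_family_def)
    have nonneg: "0 \<le> ?p m + H m n S' * (X (Suc n) - X n)" if X: "X \<in> node \<S> S' n" for X m
    proof -
      have "0 \<le> portfolio (V m) (H m) j (Suc n) X"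
        using fam N[OF X] Suc.hyps by (simp add: nonneg_family_def)
      then show ?thesis
        using portfolio_eq_on_node[OF str Suc.hyps S'(1) N[OF X] X]
          strategies_eq_on_node[OF str Suc.hyps S'(1) N[OF X] X] Suc.hyps
        by (simp add: portfolio_Suc)
    qed
    \<comment> \<open>\<open>U\<close> and \<open>D\<close> share the past of \<open>S'\<close>,
      hence its wealth and position at time \<open>n\<close>. Nonnegative wealth after the up move
      bounds the position from below, after the down move from above; the sum of the two bounds
      serves for the absolute value.\<close>
    have bound: "norm (H m n S') \<le> ?p m * (1 / u + 1 / d)" for m
    proof -
      have p: "0 \<le> ?p m"
        using fam S'(1) Suc.hyps by (simp add: nonneg_family_def)
      have "0 \<le> ?p m + H m n S' * u" "0 \<le> ?p m - H m n S' * d"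
        using nonneg[OF U(1), of m] nonneg[OF D(1), of m] by (simp_all add: u_def d_def algebra_simps)
      then have "- H m n S' \<le> ?p m / u" "H m n S' \<le> ?p m / d"
        using ud by (simp_all add: field_simps)
      moreover have "0 \<le> ?p m / u" "0 \<le> ?p m / d"
        using ud p by simp_all
      ultimately show ?thesis by (simp add: algebra_simps abs_le_iff)
    qed
    have "summable (\<lambda>m. H m n S')"
      by (rule summable_comparison_test'[OF summable_mult2[OF sums_summable[OF Suc.IH]] bound])
    then have "(\<lambda>m. ?p m + H m n S' * (S' (Suc n) - S' n)) sums
        (portfolio (\<Sum>m. V m) (\<lambda>i S. \<Sum>m. H m i S) j n S' + (\<Sum>m. H m n S') * (S' (Suc n) - S' n))"
      by (intro sums_add Suc.IH sums_mult2 summable_sums)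
    then show ?thesis using Suc.hyps by (simp add: portfolio_Suc)
  qed
qed

text \<open>A claim known at time \<open>T\<close> needs no trading after \<open>T\<close>: at a node satisfying \<open>(L)\<close> the
  aggregated wealth at time \<open>T\<close> already dominates it.\<close>

lemma superhedge_finite_horizon:
  assumes S: "S \<in> \<S>" and "j \<le> T"
    and F: "\<And>S' S''. S' \<in> node \<S> S j \<Longrightarrow> S'' \<in> node \<S> S' T \<Longrightarrow> F S'' = F S'"
    and cost: "sigma_on (node \<S> S j) j (\<lambda>S. ereal (F S)) < ereal c"
  obtains K where "K \<in> strategies (node \<S> S j) j"
    and "\<And>S'. S' \<in> node \<S> S j \<Longrightarrow> S' \<notin> arbitrage_paths \<S> \<Longrightarrow> L_property \<S> S' T \<Longrightarrow>
      F S' \<le> portfolio c K j T S'"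
proof -
  let ?N = "node \<S> S j"
  obtain V0 H0 n0 V H where H0: "H0 \<in> strategies ?N j" "j \<le> n0" and fam: "nonneg_family ?N j V H"
    and hedge: "\<forall>S\<in>?N. ereal (F S) \<le>
      ereal (portfolio V0 H0 j n0 S) + (\<Sum>m. liminf_portfolio (V m) (H m) j S)"
    and less: "ereal V0 + (\<Sum>m. ereal (V m)) < ereal c"
    using cost unfolding sigma_on_def Inf_less_iff by blast
  have V: "0 \<le> V m" for m
    using nonneg_family_capital[OF fam] node_self[OF S] by blast
  have fin: "(\<Sum>m. ereal (V m)) \<noteq> \<infinity>"
    using less by auto
  have sV: "summable V"
    by (rule summable_ereal[OF V fin])
  have less': "V0 + (\<Sum>m. V m) < c"
    using less suminf_ereal'[OF sV] by simp
  \<comment> \<open>The horizon \<open>n0\<close> may lie on either side of \<open>T\<close>; once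
    truncated, this strategy yields the elementary payoff at every horizon from \<open>n0\<close>
    on.\<close>
  define K0 where "K0 i S = (if i < n0 then H0 i S else 0)" for i S
  define Hs where "Hs i S = (\<Sum>m. H m i S)" for i S
  define K where "K i S = K0 i S + Hs i S" for i S
  have H: "H m \<in> strategies ?N j" for m
    using fam by (simp add: nonneg_family_def)
  have K0: "K0 \<in> strategies ?N j"
    using strategies_truncate[OF H0(1), of n0] by (simp add: K0_def[abs_def])
  have "Hs \<in> strategies ?N j"
    using strategies_suminf[of H, OF H] by (simp add: Hs_def[abs_def])
  then have K: "K \<in> strategies ?N j"
    using strategies_add[OF K0] by (simp add: K_def[abs_def])
  show thesis
  proof (rule that[OF K])
    fix S' assume S': "S' \<in> ?N" "S' \<notin> arbitrage_paths \<S>" and L: "L_property \<S> S' T"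
    \<comment> \<open>A horizon late enough both for the node at time \<open>T\<close> and for the
      elementary payoff to be complete.\<close>
    define p where "p = max n0 T"
    have p: "n0 \<le> p" "T \<le> p" by (simp_all add: p_def)
    \<comment> \<open>\<open>q\<close> and \<open>W m\<close> are the wealths at time
      \<open>T\<close> along \<open>S'\<close>; they become the capitals when the hedge is restarted
      at the time-\<open>T\<close> node.\<close>
    define q where "q = portfolio V0 K0 j T S'"
    define W where "W m = portfolio (V m) (H m) j T S'" for m
    have sub: "node \<S> S' T \<subseteq> ?N"
      by (rule node_node_subset[OF S'(1) \<open>j \<le> T\<close>])
    have fam': "nonneg_family (node \<S> S' T) T W H"
    proof -
      have "0 \<le> portfolio (W m) (H m) T n X" if X: "X \<in> node \<S> S' T" and "T \<le> n" for m n X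
      proof -
        have "portfolio (W m) (H m) T n X = portfolio (V m) (H m) j n X"
          using portfolio_split[OF \<open>j \<le> T\<close> \<open>T \<le> n\<close>, of "V m" "H m" X]
            portfolio_eq_on_node[OF H \<open>j \<le> T\<close> S'(1) _ X] sub X by (auto simp: W_def)
        then show ?thesis
          using fam sub X \<open>j \<le> T\<close> \<open>T \<le> n\<close> by (auto simp: nonneg_family_def)
      qed
      then show ?thesis
        using strategies_node_mono[OF H \<open>j \<le> T\<close> sub] by (simp add: nonneg_family_def)
    qed
    have str: "(\<lambda>i S. - 1 * K0 i S) \<in> strategies (node \<S> S' T) T"
      by (rule strategies_cmult[OF strategies_node_mono[OF K0 \<open>j \<le> T\<close> sub]])
    \<comment> \<open>On the time-\<open>T\<close> node the claim is constant, so claim minus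
      elementary payoff is itself elementary, with capital \<open>F S' - q\<close> and position
      \<open>- K0\<close>. Property (L) bounds that capital by the total capital of the restarted
      family.\<close>
    have "ereal (F S' - q) \<le> (\<Sum>m. ereal (W m))"
    proof (rule L_onD[OF _ str p(2) fam'])
      show "L_on (node \<S> S' T) T" using L by (simp add: L_property_def)
      fix X assume X: "X \<in> node \<S> S' T"
      then have XN: "X \<in> ?N" using sub by blast
      have "q = portfolio V0 K0 j T X"
        unfolding q_def by (rule portfolio_eq_on_node[OF K0 \<open>j \<le> T\<close> S'(1) XN X, symmetric])
      then have "portfolio q K0 T p X = portfolio V0 K0 j p X"
        using portfolio_split[OF \<open>j \<le> T\<close> p(2), of V0 K0 X] by simp
      also have "\<dots> = portfolio V0 H0 j n0 X"
        using portfolio_truncate[OF H0(2) p(1), of V0 H0 X] by (simp add: K0_def[abs_def])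
      finally have "portfolio (F S' - q) (\<lambda>i S. - 1 * K0 i S) T p X = F X - portfolio V0 H0 j n0 X"
        using F[OF S'(1) X] by (simp add: portfolio_def sum_negf)
      moreover have "liminf_portfolio (W m) (H m) T X = liminf_portfolio (V m) (H m) j X" for m
        unfolding W_def
        using liminf_portfolio_split[OF \<open>j \<le> T\<close>, of "V m" "H m" X]
          portfolio_eq_on_node[OF H \<open>j \<le> T\<close> S'(1) XN X] by simp
      moreover have "ereal (F X) \<le>
          ereal (portfolio V0 H0 j n0 X) + (\<Sum>m. liminf_portfolio (V m) (H m) j X)"
        using hedge XN by blast
      ultimately show "ereal (portfolio (F S' - q) (\<lambda>i S. - 1 * K0 i S) T p X)
          \<le> (\<Sum>m. liminf_portfolio (W m) (H m) T X)"
        by (cases "\<Sum>m. liminf_portfolio (V m) (H m) j X") auto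
    qed
    moreover have "W sums portfolio (\<Sum>m. V m) Hs j T S'"
      using nonneg_family_aggregate[OF fam sV S' \<open>j \<le> T\<close>] by (simp add: W_def[abs_def] Hs_def[abs_def])
    ultimately have "F S' - q \<le> portfolio (\<Sum>m. V m) Hs j T S'"
      by (simp add: sums_suminf_ereal)
    then have "F S' \<le> portfolio (V0 + (\<Sum>m. V m)) K j T S'"
      unfolding K_def[abs_def] portfolio_add by (simp add: q_def)
    also have "\<dots> \<le> portfolio c K j T S'"
      using less' by (simp add: portfolio_def)
    finally show "F S' \<le> portfolio c K j T S'" .
  qed
qed

section \<open>Upcrossing times\<close>

text \<open>The inserted \<open>T + 1\<close> keeps the set nonempty, so the infimum is attained,
  and it exceeds every \<open>i \<le> T\<close>.\<close>

lemma Inf_insert_Suc_le_iff: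
  assumes "i \<le> (T::nat)"
  shows "Inf (insert (T + 1) {n. n \<le> T \<and> P n}) \<le> i \<longleftrightarrow> (\<exists>n\<le>i. P n)"
proof
  let ?A = "{n. n \<le> T \<and> P n}"
  assume le: "Inf (insert (T + 1) ?A) \<le> i"
  have "Inf (insert (T + 1) ?A) \<in> insert (T + 1) ?A"
    by (rule Inf_nat_def1) simp
  with le assms show "\<exists>n\<le>i. P n" by auto
next
  assume "\<exists>n\<le>i. P n"
  then obtain n where "P n" "n \<le> i" by blast
  then show "Inf (insert (T + 1) {n. n \<le> T \<and> P n}) \<le> i"
    using assms cInf_lower[of n "insert (T + 1) {n. n \<le> T \<and> P n}"] by simp
qed

lemma rho_le_iff:
  assumes "i \<le> T"
  shows "rho T f a b k S \<le> i \<longleftrightarrow> (\<exists>n\<le>i. tau T f a b k S \<le> n \<and> f n S \<le> a)"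
  unfolding rho.simps by (rule Inf_insert_Suc_le_iff[OF assms])

lemma tau_Suc_le_iff:
  assumes "i \<le> T"
  shows "tau T f a b (Suc k) S \<le> i \<longleftrightarrow> (\<exists>n\<le>i. rho T f a b k S \<le> n \<and> b \<le> f n S)"
  unfolding tau.simps by (rule Inf_insert_Suc_le_iff[OF assms])

lemma rho_le_Suc: "rho T f a b k S \<le> Suc T"
  unfolding rho.simps by (rule cInf_lower) simp_all

text \<open>With \<open>i\<close> set to the value of the time itself, \<open>rho_le_iff\<close>
  gives a witness no later than that time; minimality makes the two equal.\<close>

lemma rho_attained:
  assumes "rho T f a b k S \<le> T"
  shows "f (rho T f a b k S) S \<le> a" "tau T f a b k S \<le> rho T f a b k S"
proof -
  obtain n where n: "n \<le> rho T f a b k S" "tau T f a b k S \<le> n" "f n S \<le> a"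
    using rho_le_iff[OF assms] by blast
  then have "rho T f a b k S \<le> n"
    using rho_le_iff[of n T] assms by auto
  with n have "n = rho T f a b k S" by simp
  with n show "f (rho T f a b k S) S \<le> a" "tau T f a b k S \<le> rho T f a b k S"
    by simp_all
qed

lemma tau_attained:
  assumes "tau T f a b (Suc k) S \<le> T"
  shows "b \<le> f (tau T f a b (Suc k) S) S" "rho T f a b k S \<le> tau T f a b (Suc k) S"
proof -
  obtain n where n: "n \<le> tau T f a b (Suc k) S" "rho T f a b k S \<le> n" "b \<le> f n S"
    using tau_Suc_le_iff[OF assms] by blast
  then have "tau T f a b (Suc k) S \<le> n"
    using tau_Suc_le_iff[of n T] assms by auto
  with n have "n = tau T f a b (Suc k) S" by simp
  with n show "b \<le> f (tau T f a b (Suc k) S) S" "rho T f a b k S \<le> tau T f a b (Suc k) S"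
    by simp_all
qed

lemma rho_le_tau: "rho T f a b k S \<le> tau T f a b (Suc k) S"
proof (cases "tau T f a b (Suc k) S \<le> T")
  case True
  then show ?thesis by (rule tau_attained)
next
  case False
  then show ?thesis using rho_le_Suc[of T f a b k S] by simp
qed

text \<open>Agreement of \<open>tau\<close> is a hypothesis here so that the lemma can be used
  within the induction on \<open>k\<close> that establishes it.\<close>

lemma rho_cong:
  assumes "i \<le> T" "\<And>n. n \<le> i \<Longrightarrow> f n S' = f n S"
    and tau: "\<And>n. n \<le> i \<Longrightarrow> tau T f a b k S' \<le> n \<longleftrightarrow> tau T f a b k S \<le> n"
  shows "rho T f a b k S' \<le> i \<longleftrightarrow> rho T f a b k S \<le> i"
  unfolding rho_le_iff[OF assms(1)] using assms(2) tau by (metis order_refl)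

text \<open>The stopping time property, phrased through the events \<open>tau \<le> i\<close>: paths
  that agree up to time \<open>i\<close> may still have different later values of
  \<open>tau\<close>.\<close>

lemma tau_cong:
  assumes "i \<le> T" "\<And>n. n \<le> i \<Longrightarrow> f n S' = f n S"
  shows "tau T f a b k S' \<le> i \<longleftrightarrow> tau T f a b k S \<le> i"
  using assms
proof (induction k arbitrary: i)
  case 0
  then show ?case by (simp add: tau.simps)
next
  case (Suc k)
  have "rho T f a b k S' \<le> n \<longleftrightarrow> rho T f a b k S \<le> n" if "n \<le> i" for n
    using that Suc.prems by (intro rho_cong Suc.IH) auto
  then show ?case
    unfolding tau_Suc_le_iff[OF Suc.prems(1)] using Suc.prems(2) by auto
qed

section \<open>One-step hedges of a supermartingale\<close>

lemma supermartingale_adapted: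
  assumes "supermartingale \<S> T (\<lambda>n S. ereal (f n S))" "j \<le> T" "S \<in> \<S>" "S' \<in> node \<S> S j"
  shows "f j S' = f j S"
  using assms unfolding supermartingale_def by auto

text \<open>At each node \<open>(S,j)\<close> the claim \<open>f (Suc j)\<close> costs less than
  \<open>f j S + \<epsilon>\<close>, and with horizon \<open>Suc j\<close> only the position at time
  \<open>j\<close> of its hedge matters. These positions are glued into one strategy with one
  exceptional set.\<close>

lemma supermartingale_hedge:
  fixes f :: "nat \<Rightarrow> trajectory \<Rightarrow> real"
  assumes tr: "trajectory_set s\<^sub>0 \<S>" and ne: "\<S> \<noteq> {}" and L: "L_ae \<S>"
    and sm: "supermartingale \<S> T (\<lambda>n S. ereal (f n S))" and "0 < \<epsilon>"
  obtains K E where "K \<in> strategies \<S> 0" "negligible \<S> E"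
    and "\<And>j S. j < T \<Longrightarrow> S \<in> \<S> - E \<Longrightarrow>
      f (Suc j) S \<le> f j S + \<epsilon> + K j S * (S (Suc j) - S j)"
proof -
  have "\<forall>j. \<exists>E. j < T \<longrightarrow> null \<S> E \<and>
      (\<forall>S\<in>\<S> - E. sigma_bar \<S> j (\<lambda>S. ereal (f (Suc j) S)) S \<le> ereal (f j S))"
    using sm unfolding supermartingale_def almost_everywhere_def by blast
  from choice[OF this] obtain N where N: "\<And>j. j < T \<Longrightarrow> null \<S> (N j)"
      "\<And>j S. j < T \<Longrightarrow> S \<in> \<S> - N j \<Longrightarrow>
        sigma_bar \<S> j (\<lambda>S. ereal (f (Suc j) S)) S \<le> ereal (f j S)"
    by blast
  define X where "X = {S\<in>\<S>. \<exists>j. \<not> L_property \<S> S j}"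
  \<comment> \<open>For \<open>j \<ge> T\<close> the union is filled up with \<open>X\<close>, which
    is negligible as well.\<close>
  define E where "E = arbitrage_paths \<S> \<union> (X \<union> (\<Union>j. if j < T then N j else X))"
  have "negligible \<S> X"
    using L unfolding L_ae_def X_def by (intro negligible_null[OF ne]) blast
  then have E: "negligible \<S> E"
    unfolding E_def
    by (intro negligible_Un[OF ne] negligible_UN[OF ne] negligible_arbitrage_paths[OF tr ne])
      (auto intro: negligible_null[OF ne N(1)])
  define P where "P j S h \<longleftrightarrow> (\<forall>S'\<in>node \<S> S j - E.
      f (Suc j) S' \<le> f j S' + \<epsilon> + h * (S' (Suc j) - S' j))" for j S h
  \<comment> \<open>\<open>P j S\<close> depends on \<open>S\<close> only through its node, so the
    choice is the same on the whole node and \<open>K\<close> is non-anticipative.\<close>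
  define K where "K j S = (SOME h. P j S h)" for j S
  have K: "K \<in> strategies \<S> 0"
    by (rule strategiesI_node[OF tr]) (simp add: K_def P_def node_eq)
  have "f (Suc j) S \<le> f j S + \<epsilon> + K j S * (S (Suc j) - S j)" if j: "j < T" and S: "S \<in> \<S> - E" for j S
  proof -
    have "S \<notin> N j"
      using S j unfolding E_def by (auto split: if_splits)
    then have "sigma_bar \<S> j (\<lambda>S. ereal (f (Suc j) S)) S \<le> ereal (f j S)"
      using N(2)[OF j] S by blast
    also have "\<dots> < ereal (f j S + \<epsilon>)" using \<open>0 < \<epsilon>\<close> by simp
    finally have cost: "sigma_on (node \<S> S j) j (\<lambda>S. ereal (f (Suc j) S)) < ereal (f j S + \<epsilon>)"
      by (simp add: sigma_bar_def)
    have F: "f (Suc j) S'' = f (Suc j) S'" if "S' \<in> node \<S> S j" "S'' \<in> node \<S> S' (Suc j)" for S' S''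
      using supermartingale_adapted[OF sm _ _ that(2)] that(1) node_subset j by (simp add: subset_iff)
    obtain H where H: "H \<in> strategies (node \<S> S j) j"
      and le: "\<And>S'. S' \<in> node \<S> S j \<Longrightarrow> S' \<notin> arbitrage_paths \<S> \<Longrightarrow> L_property \<S> S' (Suc j) \<Longrightarrow>
        f (Suc j) S' \<le> portfolio (f j S + \<epsilon>) H j (Suc j) S'"
      by (rule superhedge_finite_horizon[OF _ _ F cost, of "Suc j"]) (use S in auto)
    have "P j S (H j S)"
      unfolding P_def
    proof
      fix S' assume S': "S' \<in> node \<S> S j - E"
      then have "S' \<in> \<S>" using node_subset by blast
      then have "L_property \<S> S' (Suc j)"
        using S' unfolding E_def X_def by blast
      then have "f (Suc j) S' \<le> portfolio (f j S + \<epsilon>) H j (Suc j) S'"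
        using S' unfolding E_def by (intro le) blast+
      moreover have "H j S' = H j S"
        using S' S by (intro strategies_eq_on_node[OF H]) (auto simp: node_self)
      moreover have "f j S' = f j S"
        using S' S j by (intro supermartingale_adapted[OF sm]) auto
      ultimately show "f (Suc j) S' \<le> f j S' + \<epsilon> + H j S * (S' (Suc j) - S' j)"
        by (simp add: portfolio_Suc)
    qed
    then have "P j S (K j S)" unfolding K_def by (rule someI)
    then show ?thesis
      using S node_self[of S \<S> j] unfolding P_def by blast
  qed
  with K E show thesis by (rule that)
qed

section \<open>The upcrossing inequality\<close>

text \<open>Capital 1 without trading dominates any indicator, and (L) gives the lower bound. In
  particular the price is finite.\<close>

lemma sigma_bar0_indicator:
  assumes "L_on \<S> 0"
  shows "0 \<le> sigma_bar0 \<S> (indicator A)" "sigma_bar0 \<S> (indicator A) \<le> 1"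
proof -
  show "0 \<le> sigma_bar0 \<S> (indicator A)"
    by (rule sigma_bar0_nonneg[OF assms]) (simp add: indicator_def)
  have "nonneg_family \<S> 0 (\<lambda>_. 0) (\<lambda>_ _ _. 0)"
    by (simp add: nonneg_family_def strategies_zero portfolio_def)
  then have "sigma_on \<S> 0 (indicator A) \<le> ereal 1 + (\<Sum>m::nat. ereal 0)"
    by (rule sigma_on_lower[OF strategies_zero le0])
      (simp add: portfolio_def liminf_portfolio_def Liminf_const indicator_def flip: zero_ereal_def one_ereal_def)
  then show "sigma_bar0 \<S> (indicator A) \<le> 1"
    by (simp add: sigma_bar0_def flip: zero_ereal_def one_ereal_def)
qed

text \<open>The increments from \<open>r\<close> to \<open>min t T\<close> telescope, and each costs
  an error \<epsilon>. Allowing \<epsilon> also at the steps outside this window only enlarges the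
  right side and makes the total error \<open>T * \<epsilon>\<close>.\<close>

lemma stopped_gain_le:
  fixes f x :: "nat \<Rightarrow> real" and r t T :: nat
  assumes "r \<le> t" and step: "\<And>i. i < T \<Longrightarrow> f (Suc i) \<le> f i + \<epsilon> + x i" and "0 \<le> \<epsilon>"
  shows "(if r \<le> T then f (min t T) - f r else 0)
    \<le> real T * \<epsilon> + (\<Sum>i = 0..<T. if r \<le> i \<and> i < t then x i else 0)"
proof -
  have "(if r \<le> T then f (min t T) - f r else 0)
      = (\<Sum>i = 0..<T. if r \<le> i \<and> i < t then f (Suc i) - f i else 0)"
  proof (cases "r \<le> T")
    case True
    have "(\<Sum>i = 0..<T. if r \<le> i \<and> i < t then f (Suc i) - f i else 0)
        = (\<Sum>i\<in>{i \<in> {0..<T}. r \<le> i \<and> i < t}. f (Suc i) - f i)"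
      by (rule sum.inter_filter[symmetric]) simp
    also have "{i \<in> {0..<T}. r \<le> i \<and> i < t} = {r..<min t T}" by auto
    finally show ?thesis
      using True \<open>r \<le> t\<close> by (simp add: sum_Suc_diff')
  next
    case False
    then show ?thesis by (auto intro!: sum.neutral[symmetric])
  qed
  also have "\<dots> \<le> (\<Sum>i = 0..<T. \<epsilon> + (if r \<le> i \<and> i < t then x i else 0))"
    using step \<open>0 \<le> \<epsilon>\<close> by (intro sum_mono) (auto simp: algebra_simps)
  finally show ?thesis by (simp add: sum.distrib)
qed

text \<open>Pathwise, \<open>b - c\<close> times the indicator of a completed upcrossing is at most
  \<open>a - c\<close> times the indicator of a started one plus the gain of \<open>f\<close> from
  \<open>rho\<close> to \<open>tau\<close> capped at \<open>T\<close>. Both terms on the right are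
  hedged up to small errors and the sum is divided by \<open>b - c\<close>.\<close>

lemma upcrossing_step:
  fixes f :: "nat \<Rightarrow> trajectory \<Rightarrow> real"
  assumes tr: "trajectory_set s\<^sub>0 \<S>" and ne: "\<S> \<noteq> {}" and L: "L_ae \<S>"
    and sm: "supermartingale \<S> T (\<lambda>n S. ereal (f n S))"
    and c: "\<And>n S. n \<le> T \<Longrightarrow> S \<in> \<S> \<Longrightarrow> c \<le> f n S" and "c \<le> a" "a < b"
  shows "sigma_bar0 \<S> (indicator {S\<in>\<S>. tau T f a b (Suc k) S < Suc T})
    \<le> ereal ((a - c) / (b - c)) * sigma_bar0 \<S> (indicator {S\<in>\<S>. rho T f a b k S < Suc T})"
proof -
  define A where "A = {S\<in>\<S>. rho T f a b k S < Suc T}"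
  define B where "B = {S\<in>\<S>. tau T f a b (Suc k) S < Suc T}"
  obtain S\<^sub>1 where S\<^sub>1: "S\<^sub>1 \<in> \<S>" using ne by blast
  have N0: "node \<S> S\<^sub>1 0 = \<S>" by (rule node_0[OF tr S\<^sub>1])
  have L0: "L_on \<S> 0"
    using L S\<^sub>1 N0 unfolding L_ae_def L_property_def by metis
  obtain s where s: "sigma_bar0 \<S> (indicator A) = ereal s"
    using sigma_bar0_indicator[OF L0, of A] by (cases "sigma_bar0 \<S> (indicator A)") auto
  define X where "X = {S\<in>\<S>. \<exists>j. \<not> L_property \<S> S j}"
  have X: "negligible \<S> X"
    using L unfolding L_ae_def X_def by (intro negligible_null[OF ne]) blast
  have f_node: "f n S' = f n S" if "n \<le> i" "i \<le> T" "S \<in> \<S>" "S' \<in> node \<S> S i" for n i S S'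
    using that by (intro supermartingale_adapted[OF sm]) (auto intro: node_antimono[of n i])
  have tau_node: "tau T f a b l S' \<le> i \<longleftrightarrow> tau T f a b l S \<le> i"
    if "i \<le> T" "S \<in> \<S>" "S' \<in> node \<S> S i" for i l S S'
    using that by (intro tau_cong f_node) auto
  have rho_node: "rho T f a b l S' \<le> i \<longleftrightarrow> rho T f a b l S \<le> i"
    if "i \<le> T" "S \<in> \<S>" "S' \<in> node \<S> S i" for i l S S'
    using that by (intro rho_cong tau_node f_node) (auto intro: node_antimono[of _ i])
  have "sigma_bar0 \<S> (indicator B) \<le> ereal ((a - c) / (b - c) * s)"
  proof (rule ereal_le_epsilon2)
    fix \<epsilon> :: real assume "0 < \<epsilon>"
    \<comment> \<open>The error \<delta> enters \<open>a - c\<close> times through the hedge of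
      \<open>A\<close> and \<open>T\<close> times through the one-step hedges, all divided by
      \<open>b - c\<close>. The summand 1 keeps the denominator positive if \<open>a = c\<close> and
      \<open>T = 0\<close>.\<close>
    define \<delta> where "\<delta> = \<epsilon> * (b - c) / (a - c + real T + 1)"
    have pos: "0 < a - c + real T + 1" "0 < b - c" using \<open>c \<le> a\<close> \<open>a < b\<close> by auto
    then have "0 < \<delta>" using \<open>0 < \<epsilon>\<close> by (simp add: \<delta>_def)
    have cost: "sigma_on (node \<S> S\<^sub>1 0) 0 (\<lambda>S. ereal (indicator A S)) < ereal (s + \<delta>)"
      using s \<open>0 < \<delta>\<close> by (simp add: N0 sigma_bar0_def ereal_indicator)
    have F: "(indicator A S'' :: real) = indicator A S'"
      if "S' \<in> node \<S> S\<^sub>1 0" "S'' \<in> node \<S> S' T" for S' S''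
      using that rho_node[of T S' S'' k] node_subset[of \<S> S' T]
      by (auto simp: N0 A_def indicator_def less_Suc_eq_le)
    obtain K1 where K1: "K1 \<in> strategies \<S> 0"
      and hedge1: "\<And>S. S \<in> \<S> \<Longrightarrow> S \<notin> arbitrage_paths \<S> \<Longrightarrow> L_property \<S> S T \<Longrightarrow>
        indicator A S \<le> portfolio (s + \<delta>) K1 0 T S"
      by (rule superhedge_finite_horizon[OF S\<^sub>1 le0 F cost]) (auto simp: N0)
    obtain K2 E where K2: "K2 \<in> strategies \<S> 0" and E: "negligible \<S> E"
      and hedge2: "\<And>j S. j < T \<Longrightarrow> S \<in> \<S> - E \<Longrightarrow>
        f (Suc j) S \<le> f j S + \<delta> + K2 j S * (S (Suc j) - S j)"
      using supermartingale_hedge[OF tr ne L sm \<open>0 < \<delta>\<close>] by blast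
    \<comment> \<open>The one-step hedges are held from \<open>rho\<close> until just before
      \<open>tau\<close>. Both conditions concern events known at time \<open>i\<close>, and
      \<open>i < T\<close> keeps to the range where the times are non-anticipative.\<close>
    define K3 where "K3 i S = (if i < T \<and> rho T f a b k S \<le> i \<and> \<not> tau T f a b (Suc k) S \<le> i
        then K2 i S else 0)" for i S
    have K3: "K3 \<in> strategies \<S> 0"
    proof (rule strategiesI_node[OF tr])
      fix i S S' assume S: "S \<in> \<S>" "S' \<in> node \<S> S i"
      then have "K2 i S' = K2 i S"
        using node_subset by (intro strategies_eq_on_node[OF K2]) auto
      then show "K3 i S' = K3 i S"
        using rho_node[of i S S' k] tau_node[of i S S' "Suc k"] S by (auto simp: K3_def)
    qed
    define K where "K i S = 1 / (b - c) * ((a - c) * K1 i S + K3 i S)" for i S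
    define V where "V = 1 / (b - c) * ((a - c) * (s + \<delta>) + real T * \<delta>)"
    have K: "K \<in> strategies \<S> 0"
      using strategies_cmult[OF strategies_add[OF strategies_cmult[OF K1, of "a - c"] K3], of "1 / (b - c)"]
      by (simp add: K_def[abs_def])
    have "sigma_bar0 \<S> (indicator B) \<le> ereal V"
    proof (rule sigma_bar0_le_portfolio[OF ne K,
          OF negligible_Un[OF ne negligible_arbitrage_paths[OF tr ne] negligible_Un[OF ne X E]]])
      fix S assume S: "S \<in> \<S> - (arbitrage_paths \<S> \<union> (X \<union> E))"
      define r where "r = rho T f a b k S"
      define t where "t = tau T f a b (Suc k) S"
      have "r \<le> t" unfolding r_def t_def by (rule rho_le_tau)
      have "indicator A S \<le> portfolio (s + \<delta>) K1 0 T S"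
        using S by (intro hedge1) (auto simp: X_def)
      then have 1: "(a - c) * indicator A S \<le> (a - c) * portfolio (s + \<delta>) K1 0 T S"
        using \<open>c \<le> a\<close> by (intro mult_left_mono) auto
      have "(if r \<le> T then f (min t T) S - f r S else 0) \<le> real T * \<delta> +
          (\<Sum>i = 0..<T. if r \<le> i \<and> i < t then K2 i S * (S (Suc i) - S i) else 0)"
        using stopped_gain_le[of r t T "\<lambda>n. f n S" \<delta> "\<lambda>i. K2 i S * (S (Suc i) - S i)"]
          \<open>r \<le> t\<close> hedge2 S \<open>0 < \<delta>\<close> by simp
      also have "\<dots> = portfolio (real T * \<delta>) K3 0 T S"
        unfolding portfolio_def K3_def r_def t_def by (auto intro!: sum.cong)
      finally have 2: "(if r \<le> T then f (min t T) S - f r S else 0) \<le> portfolio (real T * \<delta>) K3 0 T S" .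
      \<comment> \<open>If the upcrossing completes, \<open>f\<close> has risen by at least
        \<open>b - a\<close>. If it only starts, the value at \<open>T\<close> is still at least
        \<open>c\<close>, so the loss is at most \<open>a - c\<close>. If it never starts, both
        sides vanish.\<close>
      have 3: "(b - c) * indicator B S \<le>
          (a - c) * indicator A S + (if r \<le> T then f (min t T) S - f r S else 0)"
      proof (cases "r \<le> T")
        case True
        have "f r S \<le> a" using rho_attained(1) True unfolding r_def by blast
        moreover have "c \<le> f (min t T) S" using c S by simp
        moreover have "b \<le> f (min t T) S" if "t \<le> T"
          using tau_attained(1)[of T f a b k S] that unfolding t_def by simp
        ultimately show ?thesis
          using True S by (auto simp: A_def B_def indicator_def r_def[symmetric] t_def[symmetric] less_Suc_eq_le)
      next
        case False
        then have "\<not> t \<le> T" using \<open>r \<le> t\<close> by simp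
        then show ?thesis
          using False by (simp add: A_def B_def indicator_def r_def[symmetric] t_def[symmetric] less_Suc_eq_le)
      qed
      have "(b - c) * indicator B S \<le> (a - c) * portfolio (s + \<delta>) K1 0 T S + portfolio (real T * \<delta>) K3 0 T S"
        using 1 2 3 by linarith
      also have "\<dots> = (b - c) * portfolio V K 0 T S"
        using pos unfolding V_def K_def[abs_def] portfolio_cmult portfolio_add by simp
      finally have "indicator B S \<le> portfolio V K 0 T S" using pos by simp
      then show "indicator B S \<le> ereal (portfolio V K 0 T S)"
        by (simp flip: ereal_indicator)
    qed
    also have "V \<le> (a - c) / (b - c) * s + \<epsilon>"
    proof -
      have "(a - c + real T) * \<delta> \<le> (a - c + real T + 1) * \<delta>"
        using \<open>0 < \<delta>\<close> by (intro mult_right_mono) auto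
      also have "\<dots> = \<epsilon> * (b - c)" using pos by (simp add: \<delta>_def)
      finally have "(a - c + real T) * \<delta> / (b - c) \<le> \<epsilon>"
        using pos by (simp add: pos_divide_le_eq)
      moreover have "V = (a - c) / (b - c) * s + (a - c + real T) * \<delta> / (b - c)"
        by (simp add: V_def distrib_left distrib_right add_divide_distrib)
      ultimately show ?thesis by simp
    qed
    finally show "sigma_bar0 \<S> (indicator B) \<le> ereal ((a - c) / (b - c) * s) + ereal \<epsilon>"
      by simp
  qed
  then show ?thesis using s by (simp add: A_def B_def)
qed

section \<open>Iteration over successive upcrossings\<close>

theorem theorem5p3:
  fixes s\<^sub>0 a b c :: real
    and \<S> :: "trajectory set"
    and T :: nat
    and f :: "nat \<Rightarrow> trajectory \<Rightarrow> real"
  assumes "trajectory_set s\<^sub>0 \<S>"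
    and "L_ae \<S>"
    and "supermartingale \<S> T (\<lambda>n S. ereal (f n S))"
    and "\<And>n S. n \<le> T \<Longrightarrow> S \<in> \<S> \<Longrightarrow> c \<le> f n S"
    and "c \<le> a" and "a < b"
  shows
    "\<forall>k.
      sigma_bar0 \<S> (indicator {S\<in>\<S>. tau T f a b (k + 1) S < T + 1})
        \<le> ereal ((a - c) / (b - c)) * sigma_bar0 \<S> (indicator {S\<in>\<S>. rho T f a b k S < T + 1})
      \<and> ereal ((a - c) / (b - c)) * sigma_bar0 \<S> (indicator {S\<in>\<S>. rho T f a b k S < T + 1})
        \<le> ereal ((a - c) / (b - c)) * sigma_bar0 \<S> (indicator {S\<in>\<S>. tau T f a b k S < T + 1})
      \<and> sigma_bar0 \<S> (indicator {S\<in>\<S>. tau T f a b (k + 1) S < T + 1})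
        \<le> ereal (((a - c) / (b - c)) ^ (k + 1))
            * sigma_bar0 \<S> (indicator {S\<in>\<S>. rho T f a b 0 S < T + 1})
      \<and> ereal (((a - c) / (b - c)) ^ (k + 1))
            * sigma_bar0 \<S> (indicator {S\<in>\<S>. rho T f a b 0 S < T + 1})
        \<le> ereal (((a - c) / (b - c)) ^ (k + 1))"
proof -
  define q where "q = (a - c) / (b - c)"
  have q: "0 \<le> q" using assms(5,6) by (simp add: q_def)
  define R where "R k = sigma_bar0 \<S> (indicator {S\<in>\<S>. rho T f a b k S < T + 1})" for k
  define U where "U k = sigma_bar0 \<S> (indicator {S\<in>\<S>. tau T f a b k S < T + 1})" for k
  \<comment> \<open>On an empty trajectory set every family is vacuously nonnegative, even with
    capital \<open>- 1\<close>. The empty set would then have negative outer value and not be null,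
    against \<open>L_ae\<close>.\<close>
  have ne: "\<S> \<noteq> {}"
  proof
    assume "\<S> = {}"
    then have "I_bar0 \<S> (indicator {}) \<le> (\<Sum>m::nat. ereal (if m = 0 then - 1 else 0))"
      unfolding I_bar0_def I_on_def
      by (intro Inf_lower CollectI exI[of _ "\<lambda>m. if m = 0 then - 1 else 0"] exI[of _ "\<lambda>_ _ _. 0"])
        (simp add: nonneg_family_def strategies_def)
    also have "\<dots> = ereal (- 1)"
      by (rule sums_suminf_ereal[OF sums_single[of 0 "\<lambda>_. - 1"]])
    finally show False
      using assms(2) \<open>\<S> = {}\<close> by (simp add: L_ae_def null_def)
  qed
  obtain S\<^sub>1 where S\<^sub>1: "S\<^sub>1 \<in> \<S>" using ne by blast
  have L0: "L_on \<S> 0"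
    using assms(2) S\<^sub>1 node_0[OF assms(1) S\<^sub>1] unfolding L_ae_def L_property_def by metis
  have step: "U (Suc k) \<le> ereal q * R k" for k
    using upcrossing_step[OF assms(1) ne assms(2-6)] by (simp add: U_def R_def q_def)
  have R_le_U: "R k \<le> U k" for k
    unfolding R_def U_def sigma_bar0_def
  proof (rule sigma_on_mono)
    fix S
    have "tau T f a b k S \<le> T" if "rho T f a b k S \<le> T"
      using rho_attained(2)[OF that] that by simp
    then show "(indicator {S\<in>\<S>. rho T f a b k S < T + 1} S :: ereal)
        \<le> indicator {S\<in>\<S>. tau T f a b k S < T + 1} S"
      by (auto simp: indicator_def less_Suc_eq_le)
  qed
  have mono: "ereal q * R k \<le> ereal q * U k" for k
    using R_le_U q by (intro ereal_mult_left_mono) auto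
  \<comment> \<open>Each round chains \<open>step\<close> with \<open>mono\<close>, replacing
    \<open>R\<close> by \<open>U\<close> at the same index, and so collects one factor
    \<open>q\<close>.\<close>
  have power: "U (Suc k) \<le> ereal (q ^ Suc k) * R 0" for k
  proof (induction k)
    case 0
    then show ?case using step[of 0] by simp
  next
    case (Suc k)
    have "U (Suc (Suc k)) \<le> ereal q * U (Suc k)"
      using step mono by (rule order_trans)
    also have "\<dots> \<le> ereal q * (ereal (q ^ Suc k) * R 0)"
      using Suc q by (intro ereal_mult_left_mono) auto
    also have "\<dots> = ereal (q ^ Suc (Suc k)) * R 0"
      by (simp add: mult.assoc[symmetric])
    finally show ?case .
  qed
  have "ereal (q ^ Suc k) * R 0 \<le> ereal (q ^ Suc k) * 1" for k
    unfolding R_def using q by (intro ereal_mult_left_mono sigma_bar0_indicator[OF L0]) auto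
  then show ?thesis
    using step mono power unfolding q_def R_def U_def by simp
qed

end
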